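(* Let $s\ge n+3$ and $1\le r\le n-1$, and let $X^n_s$ be the blow-up of $\mathbb{P}^n_{\mathbb{C}}$ at $s$ points in general position, with Weyl group $W^n_s$. Given $\mathcal{I},\mathcal{J}\subset\{1,\dots,s\}$ with $|\mathcal{I}|=|\mathcal{J}|=r+1$, there is $w\in W^n_s$ such that $w(c_{\mathcal{I}})=c_{\mathcal{J}}$, where $c_{\mathcal{I}}=rh-\sum_{i\in\mathcal{I}}e_i$ and $c_{\mathcal J}=rh-\sum_{i\in\mathcal{J}}e_i$.
   Context: $\mathrm{N}_1(X^n_s)_{\mathbb{R}}$ has basis $h$ (general line) and $e_i$ (line in the exceptional divisor $E_i$), $1\le i\le s$. For $\Gamma\subset\{1,\dots,s\}$ with $|\Gamma|=n+1$, the standard Cremona transformation $\mathrm{Cr}_\Gamma$ acts on $c=\delta h-\sum\mu_ie_i$ by $$\mathrm{Cr}_\Gamma(c)=(\delta-(n-1)a)h-\sum_{i\in\Gamma}(\mu_i-a)e_i-\sum_{i\notin\Gamma}\mu_ie_i,\qquad a=\sum_{i\in\Gamma}\mu_i-\delta .$$ The Weyl group $W^n_s$ is generated by the $\mathrm{Cr}_\Gamma$. *)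

theory Defs
  imports Complex_Main "HOL-Algebra.Bij" "HOL-Algebra.Generated_Groups"
begin

text \<open>
  The real vector space \<open>'v\<close> stands for the space of numerical curve classes
  \<open>N_1(X)\<close> of the blow-up \<open>X\<close> of projective \<open>n\<close>-space at \<open>s\<close> general points. It enters only
  through its basis: \<open>h\<close> is the class of a general line and \<open>e i\<close> is the class of a line in the
  exceptional divisor over the \<open>i\<close>-th point. The values of \<open>e\<close> outside \<open>{1..s}\<close> are irrelevant.
\<close>

definition curve_basis :: "nat \<Rightarrow> 'v::real_vector \<Rightarrow> (nat \<Rightarrow> 'v) \<Rightarrow> bool" where
  "curve_basis s h e \<longleftrightarrow>
     inj_on e {1..s} \<and> h \<notin> e ` {1..s} \<and>
     independent (insert h (e ` {1..s})) \<and> span (insert h (e ` {1..s})) = UNIV"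

text \<open>The coordinates in \<open>c = \<delta> h - (\<Sum>i. \<mu> i e i)\<close>; note the sign in front of \<open>\<mu>\<close>.\<close>

definition curve_degree :: "nat \<Rightarrow> 'v::real_vector \<Rightarrow> (nat \<Rightarrow> 'v) \<Rightarrow> 'v \<Rightarrow> real" where
  "curve_degree s h e c = representation (insert h (e ` {1..s})) c h"

definition curve_mult :: "nat \<Rightarrow> 'v::real_vector \<Rightarrow> (nat \<Rightarrow> 'v) \<Rightarrow> 'v \<Rightarrow> nat \<Rightarrow> real" where
  "curve_mult s h e c i = - representation (insert h (e ` {1..s})) c (e i)"

definition cremona ::
    "nat \<Rightarrow> nat \<Rightarrow> 'v::real_vector \<Rightarrow> (nat \<Rightarrow> 'v) \<Rightarrow> nat set \<Rightarrow> 'v \<Rightarrow> 'v" where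
  "cremona n s h e \<Gamma> c =
     (let \<delta> = curve_degree s h e c;
          \<mu> = curve_mult s h e c;
          a = (\<Sum>i\<in>\<Gamma>. \<mu> i) - \<delta>
      in (\<delta> - (real n - 1) * a) *\<^sub>R h
           - (\<Sum>i\<in>\<Gamma>. (\<mu> i - a) *\<^sub>R e i)
           - (\<Sum>i\<in>{1..s} - \<Gamma>. \<mu> i *\<^sub>R e i))"

text \<open>The Weyl group, as the subgroup generated inside the group of all permutations of \<open>'v\<close>;
  that its generators are permutations is \<open>cremona_Bij\<close> below.\<close>

definition weyl_group :: "nat \<Rightarrow> nat \<Rightarrow> 'v::real_vector \<Rightarrow> (nat \<Rightarrow> 'v) \<Rightarrow> ('v \<Rightarrow> 'v) set" where
  "weyl_group n s h e =
     generate (BijGroup UNIV) {cremona n s h e \<Gamma> | \<Gamma>. \<Gamma> \<subseteq> {1..s} \<and> card \<Gamma> = n + 1}"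

lemma curve_coords:
  fixes h :: "'v::real_vector" and \<delta> :: real and \<mu> :: "nat \<Rightarrow> real"
  assumes "curve_basis s h e"
  defines "c \<equiv> \<delta> *\<^sub>R h - (\<Sum>i\<in>{1..s}. \<mu> i *\<^sub>R e i)"
  shows "curve_degree s h e c = \<delta>" "i \<in> {1..s} \<Longrightarrow> curve_mult s h e c i = \<mu> i"
proof -
  let ?B = "insert h (e ` {1..s})"
  have B: "independent ?B" "span ?B = UNIV" and inj: "inj_on e {1..s}" and h: "h \<notin> e ` {1..s}"
    using assms(1) by (auto simp: curve_basis_def)
  have rep: "representation ?B c = (\<lambda>b. \<delta> * (if b = h then 1 else 0) -
      (\<Sum>j\<in>{1..s}. \<mu> j * (if b = e j then 1 else 0)))"
    unfolding c_def using B
    by (subst real_vector.representation_diff, simp, simp, simp,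
        subst real_vector.representation_sum, simp, simp,
        simp add: real_vector.representation_scale real_vector.representation_basis fun_eq_iff)
  have "(\<Sum>j\<in>{1..s}. \<mu> j * (if h = e j then 1 else 0)) = 0"
    using h by (intro sum.neutral) auto
  then show "curve_degree s h e c = \<delta>" unfolding curve_degree_def rep by simp
  assume i: "i \<in> {1..s}"
  have "(\<Sum>j\<in>{1..s}. \<mu> j * (if e i = e j then 1 else 0)) = (\<Sum>j\<in>{1..s}. if j = i then \<mu> j else 0)"
    using i inj by (intro sum.cong) (auto dest: inj_onD)
  moreover have "e i \<noteq> h" using h i by auto
  ultimately show "curve_mult s h e c i = \<mu> i" using i unfolding curve_mult_def rep by simp
qed

lemma curve_expand:
  fixes h :: "'v::real_vector"
  assumes "curve_basis s h e"
  shows "c = curve_degree s h e c *\<^sub>R h - (\<Sum>i\<in>{1..s}. curve_mult s h e c i *\<^sub>R e i)"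
proof -
  let ?B = "insert h (e ` {1..s})"
  have B: "independent ?B" "span ?B = UNIV" and inj: "inj_on e {1..s}" and h: "h \<notin> e ` {1..s}"
    using assms(1) by (auto simp: curve_basis_def)
  have "c = (\<Sum>b\<in>?B. representation ?B c b *\<^sub>R b)"
    by (rule real_vector.sum_representation_eq[symmetric]) (use B in auto)
  also have "\<dots> = representation ?B c h *\<^sub>R h + (\<Sum>b\<in>e ` {1..s}. representation ?B c b *\<^sub>R b)"
    using h by (subst sum.insert) auto
  also have "(\<Sum>b\<in>e ` {1..s}. representation ?B c b *\<^sub>R b)
      = (\<Sum>i\<in>{1..s}. representation ?B c (e i) *\<^sub>R e i)"
    using inj by (subst sum.reindex) auto
  finally show ?thesis
    by (simp add: curve_degree_def curve_mult_def sum_negf)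
qed

lemma cremona_apply:
  fixes h :: "'v::real_vector" and \<delta> :: real and \<mu> :: "nat \<Rightarrow> real"
  assumes "curve_basis s h e" "\<Gamma> \<subseteq> {1..s}"
  defines "a \<equiv> (\<Sum>i\<in>\<Gamma>. \<mu> i) - \<delta>"
  shows "cremona n s h e \<Gamma> (\<delta> *\<^sub>R h - (\<Sum>i\<in>{1..s}. \<mu> i *\<^sub>R e i)) =
    (\<delta> - (real n - 1) * a) *\<^sub>R h - (\<Sum>i\<in>{1..s}. (if i \<in> \<Gamma> then \<mu> i - a else \<mu> i) *\<^sub>R e i)"
proof -
  let ?c = "\<delta> *\<^sub>R h - (\<Sum>i\<in>{1..s}. \<mu> i *\<^sub>R e i)"
  have d: "curve_degree s h e ?c = \<delta>" by (rule curve_coords(1)[OF assms(1)])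
  have m: "curve_mult s h e ?c i = \<mu> i" if "i \<in> {1..s}" for i
    by (rule curve_coords(2)[OF assms(1) that])
  have a: "(\<Sum>i\<in>\<Gamma>. curve_mult s h e ?c i) - curve_degree s h e ?c = a"
    unfolding a_def d using assms(2) m by (intro arg_cong2[where f = minus] sum.cong) auto
  have split: "(\<Sum>i\<in>{1..s}. (if i \<in> \<Gamma> then \<mu> i - a else \<mu> i) *\<^sub>R e i)
      = (\<Sum>i\<in>{1..s} - \<Gamma>. \<mu> i *\<^sub>R e i) + (\<Sum>i\<in>\<Gamma>. (\<mu> i - a) *\<^sub>R e i)"
    using assms(2) by (subst sum.subset_diff[of \<Gamma>]) (auto intro!: arg_cong2[where f = plus] sum.cong)
  have "(\<Sum>i\<in>\<Gamma>. (curve_mult s h e ?c i - a) *\<^sub>R e i) = (\<Sum>i\<in>\<Gamma>. (\<mu> i - a) *\<^sub>R e i)"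
    using assms(2) m by (intro sum.cong) auto
  moreover have "(\<Sum>i\<in>{1..s} - \<Gamma>. curve_mult s h e ?c i *\<^sub>R e i) = (\<Sum>i\<in>{1..s} - \<Gamma>. \<mu> i *\<^sub>R e i)"
    using m by (intro sum.cong) auto
  ultimately show ?thesis
    unfolding cremona_def Let_def a split unfolding d by (simp only: diff_diff_eq add.commute)
qed

lemma cremona_involution:
  fixes h :: "'v::real_vector"
  assumes "curve_basis s h e" "\<Gamma> \<subseteq> {1..s}" "card \<Gamma> = n + 1"
  shows "cremona n s h e \<Gamma> (cremona n s h e \<Gamma> c) = c"
proof -
  define \<delta> where "\<delta> = curve_degree s h e c"
  define \<mu> where "\<mu> = curve_mult s h e c"
  define a where "a = (\<Sum>i\<in>\<Gamma>. \<mu> i) - \<delta>"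
  define \<mu>' where "\<mu>' = (\<lambda>i. if i \<in> \<Gamma> then \<mu> i - a else \<mu> i)"
  define \<delta>' where "\<delta>' = \<delta> - (real n - 1) * a"
  have c: "c = \<delta> *\<^sub>R h - (\<Sum>i\<in>{1..s}. \<mu> i *\<^sub>R e i)"
    unfolding \<delta>_def \<mu>_def by (rule curve_expand[OF assms(1)])
  have 1: "cremona n s h e \<Gamma> c = \<delta>' *\<^sub>R h - (\<Sum>i\<in>{1..s}. \<mu>' i *\<^sub>R e i)"
    unfolding \<delta>'_def \<mu>'_def a_def by (subst c, rule cremona_apply[OF assms(1,2)])
  have "(\<Sum>i\<in>\<Gamma>. \<mu>' i) = (\<Sum>i\<in>\<Gamma>. \<mu> i - a)" by (intro sum.cong) (auto simp: \<mu>'_def)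
  also have "\<dots> = (\<Sum>i\<in>\<Gamma>. \<mu> i) - (real n + 1) * a" by (simp add: sum_subtractf assms(3))
  finally have a': "(\<Sum>i\<in>\<Gamma>. \<mu>' i) - \<delta>' = - a"
    by (simp add: \<delta>'_def a_def algebra_simps)
  have "\<delta>' - (real n - 1) * (- a) = \<delta>" by (simp add: \<delta>'_def)
  moreover have "(if i \<in> \<Gamma> then \<mu>' i - (- a) else \<mu>' i) = \<mu> i" for i by (simp add: \<mu>'_def)
  ultimately show ?thesis
    unfolding 1 cremona_apply[OF assms(1,2)] a' using c by simp
qed

lemma cremona_Bij:
  fixes h :: "'v::real_vector"
  assumes "curve_basis s h e" "\<Gamma> \<subseteq> {1..s}" "card \<Gamma> = n + 1"
  shows "cremona n s h e \<Gamma> \<in> carrier (BijGroup UNIV)"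
proof -
  have "bij (cremona n s h e \<Gamma>)"
    by (rule o_bij[where g = "cremona n s h e \<Gamma>"])
       (simp_all add: fun_eq_iff cremona_involution[OF assms])
  then show ?thesis by (simp add: BijGroup_def Bij_def)
qed

end

theory Submission
  imports Defs
begin

text \<open>
  If \<open>K\<close> is disjoint from \<open>I\<close> and \<open>I \<union> K\<close> has \<open>n + 1\<close> elements, the Cremona transformation
  centred at \<open>I \<union> K\<close> sends \<open>c\<^sub>I\<close> to \<open>(r - n + 1) h + (\<Sum>k\<in>K. e k)\<close>, which remembers only \<open>K\<close>.
  Hence \<open>c\<^sub>I\<close> and \<open>c\<^sub>J\<close> are in one orbit as soon as some \<open>K\<close> with \<open>n - r\<close> elements avoids
  \<open>I \<union> J\<close>. Such a \<open>K\<close> exists if \<open>I\<close> and \<open>J\<close> differ by exchanging one element, because then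
  \<open>I \<union> J\<close> has \<open>r + 2\<close> elements and \<open>n + 2 \<le> s\<close>; and any \<open>I\<close> is turned into any \<open>J\<close> by successive
  exchanges.
\<close>

lemma id_in_weyl_group: "id \<in> weyl_group n s h e"
  using generate.one[of "BijGroup UNIV"]
  by (simp add: weyl_group_def BijGroup_def id_def restrict_UNIV)

lemma cremona_in_weyl_group:
  "\<Gamma> \<subseteq> {1..s} \<Longrightarrow> card \<Gamma> = n + 1 \<Longrightarrow> cremona n s h e \<Gamma> \<in> weyl_group n s h e"
  unfolding weyl_group_def by (rule generate.incl) blast

text \<open>Multiplication in \<open>BijGroup UNIV\<close> is restricted to its carrier, so it
  agrees with \<open>\<circ>\<close> only once the generated set is known to consist of
  bijections.\<close>

lemma comp_in_weyl_group:
  fixes h :: "'v::real_vector"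
  assumes "curve_basis s h e" "v \<in> weyl_group n s h e" "w \<in> weyl_group n s h e"
  shows "v \<circ> w \<in> weyl_group n s h e"
proof -
  let ?C = "{cremona n s h e \<Gamma> | \<Gamma>. \<Gamma> \<subseteq> {1..s} \<and> card \<Gamma> = n + 1}"
  have sub: "generate (BijGroup UNIV) ?C \<subseteq> carrier (BijGroup UNIV)"
    using cremona_Bij[OF assms(1)]
    by (intro group.generate_incl[OF group_BijGroup]) blast
  have "v \<otimes>\<^bsub>BijGroup UNIV\<^esub> w = v \<circ> w"
    using assms(2,3) sub
    by (auto simp: weyl_group_def BijGroup_def compose_def restrict_UNIV fun_eq_iff)
  then show ?thesis
    using generate.eng[of v "BijGroup UNIV" ?C w] assms(2,3) by (simp add: weyl_group_def)
qed

text \<open>The multiplicities are 1 on \<open>I\<close> and 0 elsewhere, so a = (r + 1) - r = 1.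
  Subtracting 1 on \<open>I \<union> K\<close> clears \<open>I\<close> and leaves -1 on
  \<open>K\<close>.\<close>

lemma cremona_normal_curve:
  fixes h :: "'v::real_vector"
  assumes "curve_basis s h e" "I \<subseteq> {1..s}" "K \<subseteq> {1..s}" "I \<inter> K = {}" "card I = r + 1"
  shows "cremona n s h e (I \<union> K) (real r *\<^sub>R h - (\<Sum>i\<in>I. e i)) =
    (real r - real n + 1) *\<^sub>R h + (\<Sum>i\<in>K. e i)"
proof -
  have fin: "finite I" "finite K" using assms(2,3) finite_subset by blast+
  \<comment> \<open>Indicator coefficients bring sums over subsets into the shape that
    \<open>cremona_apply\<close> expects.\<close>
  have ind: "(\<Sum>i\<in>{1..s}. (if i \<in> A then x else 0) *\<^sub>R e i) = (\<Sum>i\<in>A. x *\<^sub>R e i)"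
    if "A \<subseteq> {1..s}" for A x
    using that by (intro sum.mono_neutral_cong_right) auto
  have "(\<Sum>i\<in>I \<union> K. if i \<in> I then 1 else 0 :: real) = real (card I)"
    using fin by (simp add: sum.If_cases Int_absorb1)
  then have a: "(\<Sum>i\<in>I \<union> K. if i \<in> I then 1 else 0 :: real) - real r = 1"
    by (simp add: assms(5))
  have mu: "(if i \<in> I \<union> K then (if i \<in> I then 1 else 0) - 1 else if i \<in> I then 1 else 0 :: real)
      = (if i \<in> K then - 1 else 0)" for i
    using assms(4) by auto
  have "cremona n s h e (I \<union> K)
      (real r *\<^sub>R h - (\<Sum>i\<in>{1..s}. (if i \<in> I then 1 else 0) *\<^sub>R e i)) =
      (real r - (real n - 1) * 1) *\<^sub>R h - (\<Sum>i\<in>{1..s}. (if i \<in> K then - 1 else 0) *\<^sub>R e i)"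
    using cremona_apply[OF assms(1), of "I \<union> K" n "real r" "\<lambda>i. if i \<in> I then 1 else 0"]
      assms(2,3) unfolding a mu by blast
  then show ?thesis
    unfolding ind[OF assms(2)] ind[OF assms(3)] by (simp add: sum_negf algebra_simps)
qed

lemma weyl_equivalent_if_disjoint:
  fixes h :: "'v::real_vector"
  assumes B: "curve_basis s h e" and "I \<subseteq> {1..s}" "J \<subseteq> {1..s}" "K \<subseteq> {1..s}"
    and "card I = r + 1" "card J = r + 1" "r + card K = n"
    and "I \<inter> K = {}" "J \<inter> K = {}"
  shows "\<exists>w \<in> weyl_group n s h e.
           w (real r *\<^sub>R h - (\<Sum>i\<in>I. e i)) = real r *\<^sub>R h - (\<Sum>i\<in>J. e i)"
proof -
  have fin: "finite I" "finite J" "finite K" using assms finite_subset by blast+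
  have card: "card (I \<union> K) = n + 1" "card (J \<union> K) = n + 1"
    using assms fin by (simp_all add: card_Un_disjoint)
  have sub: "I \<union> K \<subseteq> {1..s}" "J \<union> K \<subseteq> {1..s}" using assms by auto
  have "cremona n s h e (I \<union> K) (real r *\<^sub>R h - (\<Sum>i\<in>I. e i)) =
      cremona n s h e (J \<union> K) (real r *\<^sub>R h - (\<Sum>i\<in>J. e i))"
    using assms by (simp add: cremona_normal_curve)
  \<comment> \<open>The second map is an involution, so it carries the common image back to the
    class of \<open>J\<close>.\<close>
  then have "(cremona n s h e (J \<union> K) \<circ> cremona n s h e (I \<union> K))
      (real r *\<^sub>R h - (\<Sum>i\<in>I. e i)) = real r *\<^sub>R h - (\<Sum>i\<in>J. e i)"
    by (simp add: cremona_involution[OF B sub(2) card(2)])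
  then show ?thesis
    using comp_in_weyl_group[OF B] cremona_in_weyl_group sub card by blast
qed

lemma weyl_equivalent_if_exchange:
  fixes h :: "'v::real_vector"
  assumes "curve_basis s h e" "n + 2 \<le> s" "r \<le> n" "I \<subseteq> {1..s}" "card I = r + 1"
    and i: "i \<in> I" and j: "j \<in> {1..s} - I"
  shows "\<exists>w \<in> weyl_group n s h e.
           w (real r *\<^sub>R h - (\<Sum>k\<in>I. e k)) = real r *\<^sub>R h - (\<Sum>k\<in>insert j (I - {i}). e k)"
proof -
  have fin: "finite I" using assms finite_subset by blast
  have "card ({1..s} - insert j I) = s - (r + 2)"
    using assms fin by (subst card_Diff_subset) auto
  then have "n - r \<le> card ({1..s} - insert j I)" using assms(2,3) by simp
  \<comment> \<open>Since \<open>r \<le> n\<close>, the truncated difference satisfies r + (n - r) =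
    n.\<close>
  then obtain K where K: "K \<subseteq> {1..s} - insert j I" "card K = n - r"
    by (meson obtain_subset_with_card_n)
  have "card (insert j (I - {i})) = r + 1" using assms fin by simp
  then show ?thesis
    using assms K by (intro weyl_equivalent_if_disjoint[where K = K]) auto
qed

theorem lemma6p4:
  fixes n s r :: nat
    and h :: "'v::real_vector" and e :: "nat \<Rightarrow> 'v"
    and I J :: "nat set"
  assumes "s \<ge> n + 3" and "1 \<le> r" and "r \<le> n - 1"
    and "curve_basis s h e"
    and "I \<subseteq> {1..s}" and "card I = r + 1"
    and "J \<subseteq> {1..s}" and "card J = r + 1"
  shows "\<exists>w \<in> weyl_group n s h e.
           w (real r *\<^sub>R h - (\<Sum>i\<in>I. e i)) = real r *\<^sub>R h - (\<Sum>i\<in>J. e i)"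
  using assms(5,6)
\<comment> \<open>\<open>J\<close> stays fixed; each exchange trades an element of
  \<open>I - J\<close> for one of \<open>J - I\<close>, lowering this number by one.\<close>
proof (induction "card (I - J)" arbitrary: I)
  case 0
  have "finite I" "finite J" using 0 assms(7) finite_subset by blast+
  then have "I = J" using 0 assms(8) by (intro card_subset_eq) auto
  then show ?case by (intro bexI[OF _ id_in_weyl_group]) simp
next
  case (Suc m)
  have fin: "finite I" "finite J" using Suc.prems assms(7) finite_subset by blast+
  obtain i where i: "i \<in> I" "i \<notin> J"
    using Suc.hyps(2) by (metis Diff_iff card.empty equals0I nat.distinct(1))
  \<comment> \<open>Sets of equal finite size cannot be properly nested.\<close>
  then have "\<not> J \<subseteq> I" using card_subset_eq[OF fin(1), of J] Suc.prems(2) assms(8) by auto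
  then obtain j where j: "j \<in> J" "j \<notin> I" by blast
  define I' where "I' = insert j (I - {i})"
  have "I' - J = (I - J) - {i}" using i j by (auto simp: I'_def)
  then have "m = card (I' - J)" using Suc.hyps(2) i fin by simp
  moreover have "I' \<subseteq> {1..s}" "card I' = r + 1"
    using Suc.prems assms(7) i j fin by (auto simp: I'_def)
  ultimately obtain v where v: "v \<in> weyl_group n s h e"
      "v (real r *\<^sub>R h - (\<Sum>i\<in>I'. e i)) = real r *\<^sub>R h - (\<Sum>i\<in>J. e i)"
    using Suc.hyps(1) by blast
  have "n + 2 \<le> s" "r \<le> n" "j \<in> {1..s} - I" using assms(1,3,7) j by auto
  then obtain w where w: "w \<in> weyl_group n s h e"
      "w (real r *\<^sub>R h - (\<Sum>i\<in>I. e i)) = real r *\<^sub>R h - (\<Sum>i\<in>I'. e i)"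
    using weyl_equivalent_if_exchange[OF assms(4) _ _ Suc.prems i(1)] unfolding I'_def by blast
  show ?case
    by (rule bexI[OF _ comp_in_weyl_group[OF assms(4) v(1) w(1)]]) (simp add: v(2) w(2))
qed

end
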